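(* Let $\mathcal{G}$ be a strongly connected network with adjacency matrix $A$ and let $\rho$ be the Perron eigenvalue (spectral radius) of $A$. For a node $i$ let $a_i(\ell)$ be the number of walks of length $\ell$ in $\mathcal{G}$ terminating at $i$. Then: (a) For every node $i$ the limit $\delta(i)=\lim_{\ell\to\infty}(a_i(\ell))^{1/\ell}$ exists (node $i$ has a well-defined branching ratio). (b) $\delta(i)=\rho$ for every node $i$. (c) All nodes of $\mathcal{G}$ have the same branching ratio.
   Context: A network is a finite directed multigraph (self-loops and multiple edges allowed). If its nodes are $1,\dots,n$, its adjacency matrix is the $n\times n$ matrix whose $(i,j)$ entry is the number of edges from $i$ to $j$. A walk of length $\ell$ from $j$ to $i$ is a sequence of nodes and edges $i=x_0\stackrel{e_1}{\leftarrow}x_1\stackrel{e_2}{\leftarrow}\cdots\stackrel{e_\ell}{\leftarrow}x_\ell=j$ with $e_t$ an edge from $x_t$ to $x_{t-1}$ (for $\ell=0$ it is a single node); it terminates at $i$. Different parallel edges give different walks; nodes and edges may repeat. A network is strongly connected if for any two distinct nodes $i,j$ there is a walk from $i$ to $j$. The Perron eigenvalue of a non-negative square matrix is its spectral radius (the maximum absolute value of its eigenvalues), which is itself an eigenvalue. *)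

theory Defs
  imports
    Complex_Main
    "Graph_Theory.Digraph_Component"
    "Jordan_Normal_Form.Spectral_Radius"
begin

text \<open>
  A network is a \<^locale>\<open>fin_digraph\<close>: finitely many vertices and arcs, with loops and parallel arcs
  allowed.
\<close>

text \<open>
  The list \<open>vs\<close> is an enumeration of the nodes (intended: distinct, with \<open>set vs = verts G\<close>); rows
  and columns are indexed from 0.
\<close>

definition adjacency_matrix :: "('a, 'b) pre_digraph \<Rightarrow> 'a list \<Rightarrow> nat mat" where
  "adjacency_matrix G vs =
     mat (length vs) (length vs)
       (\<lambda>(i, j). card {e \<in> arcs G. tail G e = vs ! i \<and> head G e = vs ! j})"

definition perron_eigenvalue :: "nat mat \<Rightarrow> real" where
  "perron_eigenvalue A = spectral_radius (map_mat of_nat A)"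

text \<open>
  A walk from \<open>u\<close> is given by \<open>u\<close> together with its list of arcs. The start node has to be recorded
  because the empty list of arcs is a walk at every node; for a nonempty list it is redundant.
\<close>

definition walks_to :: "('a, 'b) pre_digraph \<Rightarrow> 'a \<Rightarrow> nat \<Rightarrow> ('a \<times> 'b list) set" where
  "walks_to G i l = {(u, p). pre_digraph.awalk G u p i \<and> length p = l}"

definition num_walks_to :: "('a, 'b) pre_digraph \<Rightarrow> 'a \<Rightarrow> nat \<Rightarrow> nat" where
  "num_walks_to G i l = card (walks_to G i l)"

definition has_branching_ratio :: "('a, 'b) pre_digraph \<Rightarrow> 'a \<Rightarrow> bool" where
  "has_branching_ratio G i \<longleftrightarrow> convergent (\<lambda>l. root l (real (num_walks_to G i l)))"

text \<open>Only meaningful for nodes satisfying \<^const>\<open>has_branching_ratio\<close>.\<close>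

definition branching_ratio :: "('a, 'b) pre_digraph \<Rightarrow> 'a \<Rightarrow> real" where
  "branching_ratio G i = lim (\<lambda>l. root l (real (num_walks_to G i l)))"

end

theory Submission
  imports Defs
begin

text \<open>
  Write \<open>a\<^sub>i(l)\<close> for the number of walks of length \<open>l\<close> ending at \<open>i\<close>. Removing the last arc gives
  \<open>a\<^sub>i(l+1) = \<Sum>\<^sub>e a\<^bsub>tail e\<^esub>(l)\<close> over the arcs \<open>e\<close> into \<open>i\<close>, that is, the row vectors \<open>a(l)\<close> satisfy
  \<open>a(0) = 1\<close> and \<open>a(l+1) = a(l) A\<close>. The theorem follows by squeezing \<open>a\<^sub>i(l)\<close> between constant
  multiples of \<open>\<rho>^l\<close> and \<open>r^l\<close>, for each \<open>r > \<rho>\<close>; the \<open>l\<close>-th root forgets the constants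
  (\<open>root_tendsto_growth_rate\<close>).

  The upper bound (\<open>perron_growth_upper_bound\<close>) is a fact about matrix powers: \<open>a\<^sub>i(l)\<close> is a
  column sum of \<open>A^l\<close>, and the powers of \<open>A/r\<close>, whose spectral radius is below 1, are bounded.

  The lower bound uses strong connectivity, in place of the existence of a positive Perron vector,
  in the form that all the counts \<open>a\<^sub>j(l)\<close> of the same length \<open>l\<close> are comparable: there is a \<open>C\<close>
  with \<open>a\<^sub>j(l) \<le> C a\<^sub>i(l)\<close> for all \<open>j\<close> and \<open>l\<close> (\<open>num_walks_to_comparable\<close>). Indeed, walks ending at
  \<open>j\<close> can be prolonged to \<open>i\<close> along a fixed walk from \<open>j\<close> to \<open>i\<close>, and the added length can be removed
  again at the start of the walk at the price of a bounded factor. Now let \<open>v\<close> be an eigenvector for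
  an eigenvalue of modulus \<open>\<rho>\<close>, and \<open>w = \<bar>v\<bar>\<close> entrywise. The triangle inequality gives
  \<open>\<rho> w \<le> A w\<close>, so \<open>a(l) \<cdot> w \<ge> \<rho>^l (1 \<cdot> w)\<close> by induction; and \<open>a(l) \<cdot> w \<le> C a\<^sub>i(l) (1 \<cdot> w)\<close> by
  comparability. Since \<open>1 \<cdot> w > 0\<close>, it follows that \<open>\<rho>^l \<le> C a\<^sub>i(l)\<close>.
\<close>

section \<open>Exponential growth rates\<close>

lemma root_tendsto_growth_rate:
  fixes x :: "nat \<Rightarrow> real"
  assumes "\<rho> \<ge> 0" "C > 0"
    and lower: "\<And>l. \<rho> ^ l \<le> C * x l"
    and upper: "\<And>r. r > \<rho> \<Longrightarrow> \<exists>K. \<forall>l. x l \<le> K * r ^ l"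
  shows "(\<lambda>l. root l (x l)) \<longlonglongrightarrow> \<rho>"
proof (rule order_tendstoI)
  fix a assume "a < \<rho>"
  have "(\<lambda>l. root l (1 / C) * \<rho>) \<longlonglongrightarrow> 1 * \<rho>"
    using \<open>C > 0\<close> by (intro tendsto_mult LIMSEQ_root_const tendsto_const) auto
  hence "\<forall>\<^sub>F l in sequentially. a < root l (1 / C) * \<rho>"
    using \<open>a < \<rho>\<close> by (intro order_tendstoD(1)) auto
  thus "\<forall>\<^sub>F l in sequentially. a < root l (x l)"
    using eventually_gt_at_top[of 0]
  proof eventually_elim
    case (elim l)
    have "root l (1 / C) * \<rho> = root l (1 / C * \<rho> ^ l)"
      using elim \<open>\<rho> \<ge> 0\<close>
      by (simp add: real_root_mult real_root_divide real_root_power_cancel)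
    also have "\<dots> \<le> root l (x l)"
      using elim \<open>C > 0\<close> lower[of l] by (intro real_root_le_mono) (auto simp: field_simps)
    finally show ?case using elim by simp
  qed
next
  fix a assume "\<rho> < a"
  then obtain r where r: "\<rho> < r" "r < a" using dense by blast
  obtain K0 where K0: "\<And>l. x l \<le> K0 * r ^ l" using upper[OF r(1)] by blast
  define K where "K = max K0 1"
  have "r > 0" using r \<open>\<rho> \<ge> 0\<close> by simp
  have K: "x l \<le> K * r ^ l" for l
    by (rule order_trans[OF K0]) (use \<open>r > 0\<close> in \<open>auto simp: K_def intro!: mult_right_mono\<close>)
  have "(\<lambda>l. root l K * r) \<longlonglongrightarrow> 1 * r"
    by (intro tendsto_mult LIMSEQ_root_const tendsto_const) (auto simp: K_def)
  hence "\<forall>\<^sub>F l in sequentially. root l K * r < a"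
    using r by (intro order_tendstoD(2)) auto
  thus "\<forall>\<^sub>F l in sequentially. root l (x l) < a"
    using eventually_gt_at_top[of 0]
  proof eventually_elim
    case (elim l)
    have "root l (x l) \<le> root l (K * r ^ l)"
      using elim K by (intro real_root_le_mono) auto
    also have "\<dots> = root l K * r"
      using elim \<open>r > 0\<close> by (simp add: real_root_mult real_root_power_cancel)
    finally show ?case using elim by simp
  qed
qed

section \<open>The spectral radius of a non-negative matrix\<close>

lemma spectral_radius_smult_le:
  fixes A :: "complex mat"
  assumes A: "A \<in> carrier_mat n n" and "n > 0" and "c \<noteq> 0"
  shows "spectral_radius (c \<cdot>\<^sub>m A) \<le> norm c * spectral_radius A"
proof -
  have "spectral_radius (c \<cdot>\<^sub>m A) \<in> norm ` spectrum (c \<cdot>\<^sub>m A)"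
    using A \<open>n > 0\<close> by (intro spectral_radius_mem_max(1)) auto
  then obtain k where k: "spectral_radius (c \<cdot>\<^sub>m A) = norm k" "eigenvalue (c \<cdot>\<^sub>m A) k"
    by (auto simp: spectrum_def)
  then obtain v where v: "v \<in> carrier_vec n" "v \<noteq> 0\<^sub>v n" "(c \<cdot>\<^sub>m A) *\<^sub>v v = k \<cdot>\<^sub>v v"
    using A by (auto simp: eigenvalue_def eigenvector_def)
  have "A *\<^sub>v v = (k / c) \<cdot>\<^sub>v v"
  proof (rule eq_vecI)
    fix i assume "i < dim_vec ((k / c) \<cdot>\<^sub>v v)"
    hence i: "i < n" using v by simp
    have "((c \<cdot>\<^sub>m A) *\<^sub>v v) $ i = k * v $ i" using v i by simp
    moreover have "((c \<cdot>\<^sub>m A) *\<^sub>v v) $ i = c * (A *\<^sub>v v) $ i"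
      using A v(1) i by (simp add: scalar_prod_def sum_distrib_left mult.assoc)
    ultimately show "(A *\<^sub>v v) $ i = ((k / c) \<cdot>\<^sub>v v) $ i"
      using \<open>c \<noteq> 0\<close> v i by (simp add: field_simps)
  qed (use A v in auto)
  hence "eigenvalue A (k / c)"
    using A v by (auto simp: eigenvalue_def eigenvector_def)
  hence "norm (k / c) \<le> spectral_radius A"
    using A \<open>n > 0\<close> by (intro spectral_radius_mem_max(2)) (auto simp: spectrum_def)
  thus ?thesis using k \<open>c \<noteq> 0\<close> by (simp add: norm_divide field_simps)
qed

lemma perron_eigenvalue_nonneg:
  assumes "A \<in> carrier_mat n n" "n > 0"
  shows "perron_eigenvalue A \<ge> 0"
  using spectral_radius_mem_max(1)[of "map_mat of_nat A" n] assms
  by (auto simp: perron_eigenvalue_def)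

text \<open>
  The vector is the entrywise modulus of an eigenvector for an eigenvalue of maximal modulus, and the
  inequality is the triangle inequality. It stands in for a Perron vector: iterating the inequality
  gives lower bounds for the powers of \<open>A\<close>, and the positive total weight makes them non-trivial.
\<close>

lemma perron_subinvariant_vector:
  assumes A: "A \<in> carrier_mat n n" and "n > 0"
  obtains w :: "nat \<Rightarrow> real"
  where "\<And>k. w k \<ge> 0" and "(\<Sum>k<n. w k) > 0"
    and "\<And>k. k < n \<Longrightarrow> perron_eigenvalue A * w k \<le> (\<Sum>j<n. real (A $$ (k, j)) * w j)"
proof -
  define B :: "complex mat" where "B = map_mat of_nat A"
  have B: "B \<in> carrier_mat n n" using A by (simp add: B_def)
  obtain k where k: "perron_eigenvalue A = norm k" "eigenvalue B k"
    using spectral_radius_mem_max(1)[OF B \<open>n > 0\<close>]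
    by (auto simp: spectrum_def perron_eigenvalue_def B_def)
  then obtain v where v: "v \<in> carrier_vec n" "v \<noteq> 0\<^sub>v n" "B *\<^sub>v v = k \<cdot>\<^sub>v v"
    using B by (auto simp: eigenvalue_def eigenvector_def)
  show ?thesis
  proof
    show "norm (v $ j) \<ge> 0" for j by simp
    obtain j where "j < n" "v $ j \<noteq> 0"
      using v(1,2) by (metis carrier_vecD eq_vecI index_zero_vec)
    thus "(\<Sum>j<n. norm (v $ j)) > 0" by (intro sum_pos2[of _ j]) auto
    fix i assume i: "i < n"
    have "k * v $ i = (B *\<^sub>v v) $ i" using v i by simp
    also have "\<dots> = (\<Sum>j<n. of_nat (A $$ (i, j)) * v $ j)"
      using A v(1) i by (simp add: scalar_prod_def B_def atLeast0LessThan)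
    finally have "norm k * norm (v $ i) = norm (\<Sum>j<n. of_nat (A $$ (i, j)) * v $ j)"
      by (metis norm_mult)
    also have "\<dots> \<le> (\<Sum>j<n. norm (of_nat (A $$ (i, j)) * v $ j))"
      by (rule norm_sum)
    also have "\<dots> = (\<Sum>j<n. real (A $$ (i, j)) * norm (v $ j))"
      by (simp add: norm_mult)
    finally show "perron_eigenvalue A * norm (v $ i) \<le> (\<Sum>j<n. real (A $$ (i, j)) * norm (v $ j))"
      using k by simp
  qed
qed

section \<open>Iterating a non-negative matrix on the all-ones row vector\<close>

locale ones_orbit =
  fixes A :: "nat mat" and n :: nat and x :: "nat \<Rightarrow> nat \<Rightarrow> nat"
  assumes A: "A \<in> carrier_mat n n" and n_pos: "n > 0"
    and x_0: "\<And>j. j < n \<Longrightarrow> x 0 j = 1"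
    and x_Suc: "\<And>l j. j < n \<Longrightarrow> x (Suc l) j = (\<Sum>k<n. x l k * A $$ (k, j))"
begin

text \<open>
  The \<open>l\<close>-th vector consists of the column sums of \<open>A^l\<close>. Scaling by \<open>1 / r\<close> brings the spectral radius
  below 1, where the Jordan normal form bounds all powers uniformly.
\<close>

lemma perron_growth_upper_bound:
  assumes r: "r > perron_eigenvalue A"
  shows "\<exists>K. \<forall>l. \<forall>j<n. real (x l j) \<le> K * r ^ l"
proof -
  have "r > 0" using perron_eigenvalue_nonneg[OF A n_pos] r by simp
  define B :: "complex mat" where "B = of_real (1 / r) \<cdot>\<^sub>m map_mat of_nat A"
  have B: "B \<in> carrier_mat n n" using A by (simp add: B_def)
  have "spectral_radius B \<le> (1 / r) * perron_eigenvalue A"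
    using spectral_radius_smult_le[of "map_mat of_nat A" n "of_real (1 / r)"] A n_pos \<open>r > 0\<close>
    by (simp add: B_def perron_eigenvalue_def norm_divide)
  also have "\<dots> < 1" using r \<open>r > 0\<close> by (simp add: field_simps)
  finally obtain c where c: "\<And>l. norm_bound (B ^\<^sub>m l) c"
    using spectral_radius_jnf_norm_bound_less_1_upper_triangular[OF B] by blast
  have column_sum: "of_nat (x l j) = of_real (r ^ l) * (\<Sum>k<n. (B ^\<^sub>m l) $$ (k, j))"
    if "j < n" for l j
    using that
  proof (induction l arbitrary: j)
    case 0
    thus ?case using B x_0 by (simp add: if_distrib sum.delta)
  next
    case (Suc l)
    have pow: "B ^\<^sub>m l \<in> carrier_mat n n" using B by (rule pow_carrier_mat)
    have "of_nat (x (Suc l) j) = (\<Sum>m<n. of_nat (x l m) * of_nat (A $$ (m, j)) :: complex)"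
      using x_Suc Suc.prems by simp
    also have "\<dots> = (\<Sum>m<n. of_real (r ^ l) * (\<Sum>k<n. (B ^\<^sub>m l) $$ (k, m)) * (of_real r * B $$ (m, j)))"
      using Suc A \<open>r > 0\<close> by (intro sum.cong) (auto simp: B_def)
    also have "\<dots> = of_real (r ^ Suc l) * (\<Sum>m<n. \<Sum>k<n. (B ^\<^sub>m l) $$ (k, m) * B $$ (m, j))"
      by (simp add: sum_distrib_left sum_distrib_right mult_ac)
    also have "\<dots> = of_real (r ^ Suc l) * (\<Sum>k<n. \<Sum>m<n. (B ^\<^sub>m l) $$ (k, m) * B $$ (m, j))"
      by (subst sum.swap) simp
    also have "(\<Sum>k<n. \<Sum>m<n. (B ^\<^sub>m l) $$ (k, m) * B $$ (m, j)) = (\<Sum>k<n. (B ^\<^sub>m Suc l) $$ (k, j))"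
      using B pow Suc.prems by (intro sum.cong) (auto simp: scalar_prod_def atLeast0LessThan)
    finally show ?case .
  qed
  have "real (x l j) \<le> (real n * c) * r ^ l" if "j < n" for l j
  proof -
    have "real (x l j) = norm (of_nat (x l j) :: complex)" by simp
    also have "\<dots> = r ^ l * norm (\<Sum>k<n. (B ^\<^sub>m l) $$ (k, j))"
      unfolding column_sum[OF that] using \<open>r > 0\<close> by (simp add: norm_mult norm_power)
    also have "norm (\<Sum>k<n. (B ^\<^sub>m l) $$ (k, j)) \<le> (\<Sum>k<n. c)"
      using c[of l] B that pow_carrier_mat[OF B, of l]
      by (intro sum_norm_le) (auto simp: norm_bound_def)
    finally show ?thesis using \<open>r > 0\<close> by (simp add: mult_ac)
  qed
  thus ?thesis by blast
qed

text \<open>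
  Paired with a subinvariant vector \<open>w\<close>, the orbit grows at least like \<open>\<rho>^l\<close>. Comparability replaces all
  entries of the orbit by the \<open>i\<close>-th one, after which the total weight of \<open>w\<close> cancels.
\<close>

lemma perron_growth_lower_bound:
  assumes "i < n" and comparable: "\<And>l j. j < n \<Longrightarrow> real (x l j) \<le> C * real (x l i)"
  shows "perron_eigenvalue A ^ l \<le> C * real (x l i)"
proof -
  obtain w where w: "\<And>k. w k \<ge> 0" and w_pos: "(\<Sum>k<n. w k) > 0"
    and sub: "\<And>k. k < n \<Longrightarrow> perron_eigenvalue A * w k \<le> (\<Sum>j<n. real (A $$ (k, j)) * w j)"
    using perron_subinvariant_vector[OF A n_pos] by blast
  have "perron_eigenvalue A ^ l * (\<Sum>k<n. w k) \<le> (\<Sum>k<n. real (x l k) * w k)" for l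
  proof (induction l)
    case 0
    thus ?case using x_0 by simp
  next
    case (Suc l)
    have "perron_eigenvalue A ^ Suc l * (\<Sum>k<n. w k)
        \<le> perron_eigenvalue A * (\<Sum>k<n. real (x l k) * w k)"
      using Suc perron_eigenvalue_nonneg[OF A n_pos] by (simp add: mult.assoc mult_left_mono)
    also have "\<dots> = (\<Sum>k<n. real (x l k) * (perron_eigenvalue A * w k))"
      by (simp add: sum_distrib_left mult_ac)
    also have "\<dots> \<le> (\<Sum>k<n. real (x l k) * (\<Sum>j<n. real (A $$ (k, j)) * w j))"
      using sub by (intro sum_mono mult_left_mono) auto
    also have "\<dots> = (\<Sum>k<n. \<Sum>j<n. real (x l k) * real (A $$ (k, j)) * w j)"
      by (simp add: sum_distrib_left mult_ac)
    also have "\<dots> = (\<Sum>j<n. \<Sum>k<n. real (x l k) * real (A $$ (k, j)) * w j)"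
      by (rule sum.swap)
    also have "\<dots> = (\<Sum>j<n. real (x (Suc l) j) * w j)"
      using x_Suc by (simp add: sum_distrib_right)
    finally show ?case .
  qed
  also have "(\<Sum>k<n. real (x l k) * w k) \<le> (\<Sum>k<n. C * real (x l i) * w k)"
    using comparable w by (intro sum_mono mult_right_mono) auto
  also have "\<dots> = C * real (x l i) * (\<Sum>k<n. w k)"
    by (simp add: sum_distrib_left)
  finally show ?thesis using w_pos by simp
qed

end

section \<open>Counting walks\<close>

context fin_digraph
begin

lemma walks_to_0: "v \<in> verts G \<Longrightarrow> walks_to G v 0 = {(v, [])}"
  by (auto simp: walks_to_def awalk_Nil_iff)

lemma walks_to_Suc:
  "walks_to G v (Suc l) =
    (\<Union>e\<in>in_arcs G v. (\<lambda>(u, p). (u, p @ [e])) ` walks_to G (tail G e) l)"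
proof -
  have "(u, q) \<in> walks_to G v (Suc l) \<longleftrightarrow>
      (\<exists>e\<in>in_arcs G v. \<exists>p. q = p @ [e] \<and> (u, p) \<in> walks_to G (tail G e) l)" for u q
    by (cases q rule: rev_cases) (auto simp: walks_to_def awalk_simps)
  thus ?thesis by fastforce
qed

lemma finite_walks_to: "v \<in> verts G \<Longrightarrow> finite (walks_to G v l)"
  by (induction l arbitrary: v) (auto simp: walks_to_0 walks_to_Suc)

lemma num_walks_to_0: "v \<in> verts G \<Longrightarrow> num_walks_to G v 0 = 1"
  by (simp add: num_walks_to_def walks_to_0)

lemma num_walks_to_Suc:
  "num_walks_to G v (Suc l) = (\<Sum>e\<in>in_arcs G v. num_walks_to G (tail G e) l)"
proof -
  have "num_walks_to G v (Suc l) =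
      (\<Sum>e\<in>in_arcs G v. card ((\<lambda>(u, p). (u, p @ [e])) ` walks_to G (tail G e) l))"
    unfolding num_walks_to_def walks_to_Suc
    by (intro card_UN_disjoint) (auto intro!: finite_walks_to)
  also have "\<dots> = (\<Sum>e\<in>in_arcs G v. num_walks_to G (tail G e) l)"
    unfolding num_walks_to_def by (intro sum.cong card_image refl) (auto simp: inj_on_def)
  finally show ?thesis .
qed

lemma num_walks_to_Suc_adjacency_matrix:
  assumes vs: "distinct vs" "set vs = verts G" and j: "j < length vs"
  shows "num_walks_to G (vs ! j) (Suc l) =
    (\<Sum>k<length vs. num_walks_to G (vs ! k) l * adjacency_matrix G vs $$ (k, j))"
proof -
  have "num_walks_to G (vs ! j) (Suc l) =
      (\<Sum>u\<in>verts G. \<Sum>e | e \<in> in_arcs G (vs ! j) \<and> tail G e = u. num_walks_to G (tail G e) l)"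
    unfolding num_walks_to_Suc by (intro sum.group[symmetric]) auto
  also have "\<dots> = (\<Sum>u\<in>verts G.
      num_walks_to G u l * card {e \<in> arcs G. tail G e = u \<and> head G e = vs ! j})"
  proof (intro sum.cong refl)
    fix u
    have "{e. e \<in> in_arcs G (vs ! j) \<and> tail G e = u} = {e \<in> arcs G. tail G e = u \<and> head G e = vs ! j}"
      by auto
    thus "(\<Sum>e | e \<in> in_arcs G (vs ! j) \<and> tail G e = u. num_walks_to G (tail G e) l) =
        num_walks_to G u l * card {e \<in> arcs G. tail G e = u \<and> head G e = vs ! j}"
      by simp
  qed
  also have "\<dots> = (\<Sum>k<length vs.
      num_walks_to G (vs ! k) l * card {e \<in> arcs G. tail G e = vs ! k \<and> head G e = vs ! j})"
    by (intro sum.reindex_bij_betw[symmetric] bij_betw_nth) (use vs in auto)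
  finally show ?thesis using j by (simp add: adjacency_matrix_def)
qed

text \<open>
  Conceptually, the first arc of a walk is deleted, and there are at most \<open>card (arcs G)\<close> choices for
  it. The recursion at the last arc gives this by induction, with the trivial bound for walks of
  length 1 as the base case.
\<close>

lemma num_walks_to_Suc_le:
  "v \<in> verts G \<Longrightarrow> num_walks_to G v (Suc l) \<le> card (arcs G) * num_walks_to G v l"
proof (induction l arbitrary: v)
  case 0
  have "num_walks_to G v (Suc 0) = (\<Sum>e\<in>in_arcs G v. 1)"
    unfolding num_walks_to_Suc by (intro sum.cong) (auto simp: num_walks_to_0)
  also have "\<dots> \<le> card (arcs G)"
    by (auto intro!: card_mono)
  finally show ?case using 0 by (simp add: num_walks_to_0)
next
  case (Suc l)
  have "num_walks_to G v (Suc (Suc l)) \<le> (\<Sum>e\<in>in_arcs G v. card (arcs G) * num_walks_to G (tail G e) l)"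
    unfolding num_walks_to_Suc[of v "Suc l"] using Suc.IH by (intro sum_mono) auto
  thus ?case by (simp add: num_walks_to_Suc[of v l] sum_distrib_left)
qed

text \<open>
  One arc \<open>e\<close> at a time: appending \<open>e\<close> turns a walk of length \<open>l\<close> ending at its tail into one of length
  \<open>l + 1\<close> ending at its head, and returning to length \<open>l\<close> costs a factor \<open>card (arcs G)\<close>.
\<close>

lemma num_walks_to_le_of_awalk:
  "awalk u p v \<Longrightarrow> num_walks_to G u l \<le> card (arcs G) ^ length p * num_walks_to G v l"
proof (induction p arbitrary: u)
  case Nil
  thus ?case by (simp add: awalk_Nil_iff)
next
  case (Cons e p)
  hence e: "e \<in> arcs G" "u = tail G e" "awalk (head G e) p v"
    by (auto simp: awalk_Cons_iff)
  have "num_walks_to G u l \<le> num_walks_to G (head G e) (Suc l)"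
    unfolding num_walks_to_Suc e(2)
    using e(1) by (intro member_le_sum[of e _ "\<lambda>e. num_walks_to G (tail G e) l"]) auto
  also have "\<dots> \<le> card (arcs G) * num_walks_to G (head G e) l"
    using e(1) by (intro num_walks_to_Suc_le) auto
  also have "\<dots> \<le> card (arcs G) * (card (arcs G) ^ length p * num_walks_to G v l)"
    using Cons.IH[OF e(3)] by (intro mult_left_mono) auto
  finally show ?case by (simp add: mult.assoc)
qed

lemma num_walks_to_comparable:
  assumes "strongly_connected G" and "i \<in> verts G"
  obtains C where "C > 0" and "\<And>j l. j \<in> verts G \<Longrightarrow> num_walks_to G j l \<le> C * num_walks_to G i l"
proof -
  have "\<exists>p. awalk j p i" if "j \<in> verts G" for j
    using assms that reachable_awalk by (auto simp: strongly_connected_def)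
  then obtain P where P: "\<And>j. j \<in> verts G \<Longrightarrow> awalk j (P j) i" by metis
  define C where "C = 1 + (\<Sum>j\<in>verts G. card (arcs G) ^ length (P j))"
  show ?thesis
  proof
    show "C > 0" by (simp add: C_def)
    fix j l assume j: "j \<in> verts G"
    have "card (arcs G) ^ length (P j) \<le> C"
      unfolding C_def using j
      by (intro trans_le_add2 member_le_sum[of j _ "\<lambda>j. card (arcs G) ^ length (P j)"]) auto
    thus "num_walks_to G j l \<le> C * num_walks_to G i l"
      using num_walks_to_le_of_awalk[OF P[OF j], of l] by (meson mult_le_mono1 order_trans)
  qed
qed

end

section \<open>The branching ratio\<close>

lemma root_num_walks_to_tendsto_perron_eigenvalue:
  assumes "fin_digraph G" and "strongly_connected G"
    and vs: "distinct vs" "set vs = verts G" and i: "i \<in> verts G"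
  shows "(\<lambda>l. root l (real (num_walks_to G i l))) \<longlonglongrightarrow> perron_eigenvalue (adjacency_matrix G vs)"
proof -
  interpret fin_digraph G by fact
  obtain m where m: "m < length vs" "i = vs ! m"
    using i vs by (metis in_set_conv_nth)
  interpret ones_orbit "adjacency_matrix G vs" "length vs" "\<lambda>l k. num_walks_to G (vs ! k) l"
    using num_walks_to_Suc_adjacency_matrix[OF vs] m vs
    by unfold_locales (auto simp: adjacency_matrix_def num_walks_to_0 simp flip: vs(2))
  obtain C where C: "C > 0" "\<And>j l. j \<in> verts G \<Longrightarrow> num_walks_to G j l \<le> C * num_walks_to G i l"
    using num_walks_to_comparable[OF assms(2) i] by blast
  show ?thesis
  proof (rule root_tendsto_growth_rate)
    show "perron_eigenvalue (adjacency_matrix G vs) \<ge> 0"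
      by (rule perron_eigenvalue_nonneg[OF A n_pos])
    show "real C > 0" using C by simp
    have "real (num_walks_to G (vs ! j) l) \<le> real C * real (num_walks_to G (vs ! m) l)"
      if "j < length vs" for j l
      using C(2)[of "vs ! j" l] that vs m by (metis nth_mem of_nat_le_iff of_nat_mult)
    from perron_growth_lower_bound[OF m(1) this]
    show "perron_eigenvalue (adjacency_matrix G vs) ^ l \<le> real C * real (num_walks_to G i l)" for l
      using m by simp
    show "\<exists>K. \<forall>l. real (num_walks_to G i l) \<le> K * r ^ l"
      if "r > perron_eigenvalue (adjacency_matrix G vs)" for r
      using perron_growth_upper_bound[OF that] m by blast
  qed
qed

theorem theorem6p1:
  fixes G :: "('a, 'b) pre_digraph" and vs :: "'a list"
  assumes "fin_digraph G"
    and "strongly_connected G"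
    and "distinct vs" and "set vs = verts G"
  shows "(\<forall>i \<in> verts G. has_branching_ratio G i) \<and>
    (\<forall>i \<in> verts G. branching_ratio G i = perron_eigenvalue (adjacency_matrix G vs)) \<and>
    (\<forall>i \<in> verts G. \<forall>j \<in> verts G. branching_ratio G i = branching_ratio G j)"
proof -
  note lim = root_num_walks_to_tendsto_perron_eigenvalue[OF assms]
  have "has_branching_ratio G i" if "i \<in> verts G" for i
    using lim[OF that] by (auto simp: has_branching_ratio_def convergent_def)
  moreover have "branching_ratio G i = perron_eigenvalue (adjacency_matrix G vs)"
    if "i \<in> verts G" for i
    using lim[OF that] by (simp add: branching_ratio_def limI)
  ultimately show ?thesis by simp
qed

end
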